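(* For the code-capacity repetition-code decoder with clock period $q\ge2$ on $\mathbb Z$ there exists a constant $b\ge1$ such that the following holds. Suppose the syndrome configuration is trivial for all times $t\ge t_0$ and $\mathrm{supp}(m(t_0))$ is contained in a ball of radius $r\ge1$ centered at $x_0$. Then: 1. $\mathrm{supp}(m(t))=\varnothing$ for all $t\ge t_0+br$. 2. $\mathrm{supp}(m(t))\subseteq B_{br}(x_0)$ for all $t\ge t_0$.
   Context: Repetition code on $\mathbb Z$: one qubit and one parity check per site; the check at $x$ is $Z_xZ_{x+1}$, so an $X$ flip of qubit $x$ toggles the syndromes at $x-1$ and $x$. $B_r(x)=\{y\in\mathbb Z:|x-y|\le r\}$; $\mathrm{supp}(m(t))=\{x:m(x,t)\ne0\}$. Decoder: each site $x$ at time $t\in\mathbb Z_{\ge0}$ has bits $e(x,t)$ (correction), $s(x,t)$ (syndrome), $m(x,t)$ (message) and a clock $c(x,t)\in\{0,\dots,q-1\}$, where $q\ge2$ is a fixed integer. All clocks are zero at $t=0$ (hence synchronized). All sites update synchronously from $t$ to $t+1$: - $c(x,t+1)=(c(x,t)+1)\bmod q$. - $e(x,t+1)=e(x,t)\oplus[s(x,t)=1\text{ and }m(x-1,t)=1]$. - $s(\cdot,t+1)$ is $s(\cdot,t)$ updated according to the changes in $e$. - $m(x,t+1)=1$ iff at least one of: (i) $s(x,t)=1$; (ii) $s(x+1,t)=1$ and $m(x,t)=1$; (iii) $s(x,t)=0$, $m(x,t)=0$, $c(x,t)=0$ and $m(x-1,t)=1$; (iv) $s(x,t)=0$, $m(x,t)=1$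 and $m(x-1,t)=1$. Otherwise $m(x,t+1)=0$. *)

theory Defs
  imports Complex_Main
begin

text \<open>Bits are booleans; sites, qubits and checks are all indexed by the integers.\<close>

record config =
  corr :: "int \<Rightarrow> bool"
  synd :: "int \<Rightarrow> bool"
  msg :: "int \<Rightarrow> bool"
  clk :: "int \<Rightarrow> nat"

text \<open>The check at \<open>x\<close> acts on the qubits \<open>x\<close> and \<open>x + 1\<close>, so flipping qubit \<open>x\<close>
  toggles the syndromes at \<open>x - 1\<close> and \<open>x\<close>.\<close>

definition syndrome_of :: "(int \<Rightarrow> bool) \<Rightarrow> int \<Rightarrow> bool" where
  "syndrome_of f x \<longleftrightarrow> (f x \<noteq> f (x + 1))"

definition next_corr :: "config \<Rightarrow> int \<Rightarrow> bool" where
  "next_corr \<sigma> x \<longleftrightarrow> (corr \<sigma> x \<noteq> (synd \<sigma> x \<and> msg \<sigma> (x - 1)))"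

definition next_synd :: "config \<Rightarrow> int \<Rightarrow> bool" where
  "next_synd \<sigma> x \<longleftrightarrow>
     (synd \<sigma> x \<noteq> syndrome_of (\<lambda>y. next_corr \<sigma> y \<noteq> corr \<sigma> y) x)"

definition next_msg :: "config \<Rightarrow> int \<Rightarrow> bool" where
  "next_msg \<sigma> x \<longleftrightarrow>
     synd \<sigma> x
   \<or> (synd \<sigma> (x + 1) \<and> msg \<sigma> x)
   \<or> (\<not> synd \<sigma> x \<and> \<not> msg \<sigma> x \<and> clk \<sigma> x = 0 \<and> msg \<sigma> (x - 1))
   \<or> (\<not> synd \<sigma> x \<and> msg \<sigma> x \<and> msg \<sigma> (x - 1))"

definition decoder_step :: "nat \<Rightarrow> config \<Rightarrow> config" where
  "decoder_step q \<sigma> =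
     \<lparr>corr = next_corr \<sigma>, synd = next_synd \<sigma>, msg = next_msg \<sigma>,
      clk = (\<lambda>x. (clk \<sigma> x + 1) mod q)\<rparr>"

text \<open>Only the clocks are constrained initially; corrections, syndromes and messages
  may start in any configuration.\<close>

definition decoder_run :: "nat \<Rightarrow> (nat \<Rightarrow> config) \<Rightarrow> bool" where
  "decoder_run q \<sigma> \<longleftrightarrow>
     (\<forall>x. clk (\<sigma> 0) x = 0) \<and> (\<forall>t. \<sigma> (Suc t) = decoder_step q (\<sigma> t))"

definition msg_supp :: "config \<Rightarrow> int set" where
  "msg_supp \<sigma> = {x. msg \<sigma> x}"

definition site_ball :: "int \<Rightarrow> real \<Rightarrow> int set" where
  "site_ball x r = {y. real_of_int \<bar>x - y\<bar> \<le> r}"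

end

theory Submission
  imports Defs
begin

text \<open>Without syndromes the message rule reads \<open>m(x,t+1) = m(x-1,t) \<and> (m(x,t) \<or> c(x,t) = 0)\<close>.
  Hence the left end of the support moves right at speed 1, whereas the right end moves only when
  the clocks vanish, that is at speed \<open>1/q \<le> 1/2\<close>. The two ends meet after a time linear in the
  diameter of the initial support.\<close>

lemma decoder_run_clk:
  assumes "decoder_run q \<sigma>"
  shows "clk (\<sigma> t) x = t mod q"
proof (induction t)
  case 0
  then show ?case using assms by (simp add: decoder_run_def)
next
  case (Suc t)
  have "\<sigma> (Suc t) = decoder_step q (\<sigma> t)"
    using assms by (simp add: decoder_run_def)
  with Suc show ?case by (simp add: decoder_step_def mod_Suc_eq)
qed

text \<open>Only the last two disjuncts of \<open>next_msg\<close> survive, and both demand a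
  message on the left.\<close>

lemma decoder_run_msg_Suc:
  assumes "decoder_run q \<sigma>" and "\<And>x. \<not> synd (\<sigma> t) x"
  shows "msg (\<sigma> (Suc t)) x \<longleftrightarrow> msg (\<sigma> t) (x - 1) \<and> (msg (\<sigma> t) x \<or> t mod q = 0)"
proof -
  have "\<sigma> (Suc t) = decoder_step q (\<sigma> t)"
    using assms(1) by (simp add: decoder_run_def)
  then show ?thesis
    using assms(2) decoder_run_clk[OF assms(1), of t x]
    by (auto simp: decoder_step_def next_msg_def)
qed

text \<open>The correction term in the upper bound pays for the step by which the right end has already
  moved in the current clock period.\<close>

lemma msg_supp_drift:
  fixes l u :: real
  assumes q: "q \<ge> 2" and run: "decoder_run q \<sigma>"
    and triv: "\<And>t x. t \<ge> t0 \<Longrightarrow> \<not> synd (\<sigma> t) x"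
    and init: "\<And>y. msg (\<sigma> t0) y \<Longrightarrow> l \<le> real_of_int y \<and> real_of_int y \<le> u"
    and "msg (\<sigma> (t0 + k)) y"
  shows "l + real k \<le> real_of_int y \<and>
    2 * (real_of_int y - u) \<le> real k + (if (t0 + k) mod q = 0 then 0 else 1)"
  using \<open>msg (\<sigma> (t0 + k)) y\<close>
proof (induction k arbitrary: y)
  case 0
  then show ?case using init[of y] by simp
next
  case (Suc k)
  have prev: "msg (\<sigma> (t0 + k)) (y - 1)"
    and stay: "msg (\<sigma> (t0 + k)) y \<or> (t0 + k) mod q = 0"
    using Suc.prems decoder_run_msg_Suc[OF run triv, of "t0 + k" y] by simp_all
  show ?case
  proof (cases "(t0 + k) mod q = 0")
    case True
    \<comment> \<open>As q is at least 2, two consecutive times cannot both have clock zero. So the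
      correction grows from 0 to 1, and with the elapsed step this pays the 2 that a move of the
      right end costs.\<close>
    then have "Suc (t0 + k) mod q \<noteq> 0" using q by (simp add: mod_Suc)
    then show ?thesis using Suc.IH[OF prev] True by simp
  next
    case False
    \<comment> \<open>The hypothesis at \<open>y - 1\<close> gives the lower bound. At
      \<open>y\<close> it gives the upper one: the old correction 1 becomes the elapsed step, so
      nothing is asked of the next clock value.\<close>
    then show ?thesis using Suc.IH[OF prev] Suc.IH[of y] stay by simp
  qed
qed

theorem theorem4p7:
  fixes q :: nat
  assumes "q \<ge> 2"
  shows "\<exists>b::real. b \<ge> 1 \<and>
    (\<forall>(\<sigma> :: nat \<Rightarrow> config) (t\<^sub>0 :: nat) (x\<^sub>0 :: int) (r :: real).
       decoder_run q \<sigma> \<longrightarrow>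
       (\<forall>t\<ge>t\<^sub>0. \<forall>x. \<not> synd (\<sigma> t) x) \<longrightarrow>
       r \<ge> 1 \<longrightarrow>
       msg_supp (\<sigma> t\<^sub>0) \<subseteq> site_ball x\<^sub>0 r \<longrightarrow>
         (\<forall>t. real t \<ge> real t\<^sub>0 + b * r \<longrightarrow> msg_supp (\<sigma> t) = {}) \<and>
         (\<forall>t\<ge>t\<^sub>0. msg_supp (\<sigma> t) \<subseteq> site_ball x\<^sub>0 (b * r)))"
\<comment> \<open>If a message survives for time T, then T - r <= r + (T + 1)/2, so T <= 4r + 1 <=
  5r as r >= 1. Any factor above 5 therefore suffices for extinction.\<close>
proof (intro exI[of _ "6::real"] conjI allI impI)
  fix \<sigma> :: "nat \<Rightarrow> config" and t\<^sub>0 :: nat and x\<^sub>0 :: int and r :: real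
  assume run: "decoder_run q \<sigma>" and triv: "\<forall>t\<ge>t\<^sub>0. \<forall>x. \<not> synd (\<sigma> t) x"
    and r: "r \<ge> 1" and init: "msg_supp (\<sigma> t\<^sub>0) \<subseteq> site_ball x\<^sub>0 r"
  have ends: "real_of_int x\<^sub>0 - r \<le> real_of_int y \<and> real_of_int y \<le> real_of_int x\<^sub>0 + r"
    if "msg (\<sigma> t\<^sub>0) y" for y
  proof -
    have "real_of_int \<bar>x\<^sub>0 - y\<bar> \<le> r"
      using init that by (auto simp: msg_supp_def site_ball_def)
    then show ?thesis by (simp add: abs_le_iff)
  qed
  have drift: "real_of_int x\<^sub>0 - r + (real t - real t\<^sub>0) \<le> real_of_int y"
      "2 * (real_of_int y - (real_of_int x\<^sub>0 + r)) \<le> real t - real t\<^sub>0 + 1"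
    if "t \<ge> t\<^sub>0" "msg (\<sigma> t) y" for t y
    using msg_supp_drift[OF assms run _ ends, of t\<^sub>0 "t - t\<^sub>0" y] triv that
    by (simp_all split: if_splits)
  show "msg_supp (\<sigma> t) = {}" if "real t \<ge> real t\<^sub>0 + 6 * r" for t
  proof -
    have "t \<ge> t\<^sub>0" using that r by linarith
    have "\<not> msg (\<sigma> t) y" for y
    proof
      assume "msg (\<sigma> t) y"
      from drift[OF \<open>t \<ge> t\<^sub>0\<close> this] that r show False by (simp add: algebra_simps)
    qed
    then show ?thesis by (simp add: msg_supp_def)
  qed
  show "msg_supp (\<sigma> t) \<subseteq> site_ball x\<^sub>0 (6 * r)" if "t \<ge> t\<^sub>0" for t
  proof
    fix y assume "y \<in> msg_supp (\<sigma> t)"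
    \<comment> \<open>The time is unbounded here, but the message at \<open>y\<close> itself forces
      it to be at most 4r + 1 after the start, which keeps \<open>y\<close> within 3r + 1 <= 4r of
      the center.\<close>
    then have "\<bar>real_of_int x\<^sub>0 - real_of_int y\<bar> \<le> 6 * r"
      using drift[of t y] that r by (simp add: msg_supp_def abs_le_iff)
    then show "y \<in> site_ball x\<^sub>0 (6 * r)" by (simp add: site_ball_def)
  qed
qed simp

end
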